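(* Let $(\mathcal S,\delta)$ be a Lie bialgebra structure on the $(1+1)$-dimensional centrally extended Schrödinger algebra $\mathcal S$. Then: (1) ($D$ primitive) $\delta(D)=0$ if and only if $\delta$ is the coboundary structure given by $r=c_1D\wedge M+c_2P\wedge K$ for some $c_1,c_2\in\mathbb R$. It is standard if $c_2\neq0$ and non-standard if $c_2=0$. (2) ($P$ primitive) $\delta(P)=0$ if and only if $\delta$ is the coboundary structure given by $r=a_1D\wedge P+a_3P\wedge M+a_4H\wedge M+a_5P\wedge H+b_3K\wedge M+c_1(D\wedge M+P\wedge K)$ for some real $a_1,a_3,a_4,a_5,b_3,c_1$ with $a_1a_4+a_5c_1=0$. It is standard if $a_1b_3+c_1^2\ne0$ and non-standard if $a_1b_3+c_1^2=0$. (3) ($H$ primitive) $\delta(H)=0$ if and only if $\delta$ is the coboundary structure given by $r=a_2D\wedge H+a_3P\wedge M+a_4H\wedge M+a_5P\wedge H+c_2P\wedge K$ for some real $a_2,a_3,a_4,a_5,c_2$ with $a_2a_3+a_5c_2=0$. It is standard if $c_2\neq0$ (in which case $a_5=-a_2a_3/c_2$) and non-standard if $c_2=0$; in the non-standard case either $a_2=0$, and then also $\delta(P)=0$, or $a_3=0$ and $r=a_2D\wedge H+a_4H\wedge M+a_5P\wedge H$.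
   Context: $\mathcal S$ is the real 6-dimensional Lie algebra with basis $\{D,H,P,K,C,M\}$ and brackets $[D,P]=-P$, $[D,K]=K$, $[K,P]=M$, $[D,H]=-2H$, $[D,C]=2C$, $[H,C]=D$, $[K,H]=P$, $[K,C]=0$, $[P,C]=-K$, $[P,H]=0$, $[M,\cdot]=0$. A Lie bialgebra $(g,\delta)$ is a Lie algebra $g$ with a linear map $\delta:g\to g\otimes g$ which is a 1-cocycle, $\delta([X,Y])=[\delta(X),1\otimes Y+Y\otimes1]+[1\otimes X+X\otimes 1,\delta(Y)]$, and whose dual $\delta^*:g^*\otimes g^*\to g^*$ is a Lie bracket. The coboundary structure given by a skew-symmetric $r\in g\otimes g$ is $\delta(X)=[1\otimes X+X\otimes1,r]$. A generator $X$ is primitive if $\delta(X)=0$. Convention: $X\wedge Y=X\otimes Y-Y\otimes X$. The Schouten bracket is $[[r,r]]=[r_{12},r_{13}]+[r_{12},r_{23}]+[r_{13},r_{23}]$. A coboundary Lie bialgebra is non-standard if $[[r,r]]=0$, and standard if $[[r,r]]\neq0$ is $\mathrm{ad}$-invariant (modified classical Yang–Baxter equation). *)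

theory Defs
  imports "HOL-Analysis.Analysis"
begin

section \<open>Lie bialgebras on a finite-dimensional real coordinate space\<close>

text \<open>
  The underlying vector space is \<open>g = real^'n\<close> with the basis \<open>e\<^sub>i = axis i 1\<close>.  An element of
  \<open>g \<otimes> g\<close> (of \<open>g \<otimes> g \<otimes> g\<close>) is the array of its coefficients with respect to the tensor basis.
\<close>

abbreviation basis_vec :: "'n::finite \<Rightarrow> real^'n" where
  "basis_vec i \<equiv> axis i 1"

definition lie_bracket :: "('a::real_vector \<Rightarrow> 'a \<Rightarrow> 'a) \<Rightarrow> bool" where
  "lie_bracket br \<longleftrightarrow>
     bilinear br \<and> (\<forall>x. br x x = 0) \<and>
     (\<forall>x y z. br x (br y z) + br y (br z x) + br z (br x y) = 0)"

definition tensor2 :: "real^'n \<Rightarrow> real^'n \<Rightarrow> real^'n^'n" where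
  "tensor2 x y = (\<chi> i j. x $ i * y $ j)"

definition tensor3 :: "real^'n \<Rightarrow> real^'n \<Rightarrow> real^'n \<Rightarrow> real^'n^'n^'n" where
  "tensor3 x y z = (\<chi> i j k. x $ i * y $ j * z $ k)"

definition wedge :: "real^'n \<Rightarrow> real^'n \<Rightarrow> real^'n^'n" (infixl \<open>\<and>\<^sub>t\<close> 80) where
  "x \<and>\<^sub>t y = tensor2 x y - tensor2 y x"

definition skew_symmetric :: "real^'n^'n \<Rightarrow> bool" where
  "skew_symmetric r \<longleftrightarrow> transpose r = - r"

text \<open>\<open>ad2 br X t\<close> is \<open>[1 \<otimes> X + X \<otimes> 1, t]\<close>; \<open>ad3\<close> is the corresponding action on triple tensors.\<close>

definition ad2 ::
  "(real^'n \<Rightarrow> real^'n \<Rightarrow> real^'n) \<Rightarrow> real^'n::finite \<Rightarrow> real^'n^'n \<Rightarrow> real^'n^'n" where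
  "ad2 br X t =
     (\<Sum>i\<in>UNIV. \<Sum>j\<in>UNIV. t $ i $ j *\<^sub>R
        (tensor2 (basis_vec i) (br X (basis_vec j)) + tensor2 (br X (basis_vec i)) (basis_vec j)))"

definition ad3 ::
  "(real^'n \<Rightarrow> real^'n \<Rightarrow> real^'n) \<Rightarrow> real^'n::finite \<Rightarrow> real^'n^'n^'n \<Rightarrow> real^'n^'n^'n" where
  "ad3 br X t =
     (\<Sum>i\<in>UNIV. \<Sum>j\<in>UNIV. \<Sum>k\<in>UNIV. t $ i $ j $ k *\<^sub>R
        (tensor3 (br X (basis_vec i)) (basis_vec j) (basis_vec k) +
         tensor3 (basis_vec i) (br X (basis_vec j)) (basis_vec k) +
         tensor3 (basis_vec i) (basis_vec j) (br X (basis_vec k))))"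

definition ad_invariant3 ::
  "(real^'n \<Rightarrow> real^'n \<Rightarrow> real^'n) \<Rightarrow> real^'n::finite^'n^'n \<Rightarrow> bool" where
  "ad_invariant3 br t \<longleftrightarrow> (\<forall>X. ad3 br X t = 0)"

text \<open>
  The three summands are \<open>[r\<^sub>1\<^sub>2, r\<^sub>1\<^sub>3]\<close>, \<open>[r\<^sub>1\<^sub>2, r\<^sub>2\<^sub>3]\<close> and \<open>[r\<^sub>1\<^sub>3, r\<^sub>2\<^sub>3]\<close>, the first factor being
  expanded with the indices \<open>i, j\<close> and the second one with \<open>k, l\<close>.
\<close>

definition schouten ::
  "(real^'n \<Rightarrow> real^'n \<Rightarrow> real^'n) \<Rightarrow> real^'n::finite^'n \<Rightarrow> real^'n^'n^'n" where
  "schouten br r =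
     (\<Sum>i\<in>UNIV. \<Sum>j\<in>UNIV. \<Sum>k\<in>UNIV. \<Sum>l\<in>UNIV. (r $ i $ j * r $ k $ l) *\<^sub>R
        (tensor3 (br (basis_vec i) (basis_vec k)) (basis_vec j) (basis_vec l) +
         tensor3 (basis_vec i) (br (basis_vec j) (basis_vec k)) (basis_vec l) +
         tensor3 (basis_vec i) (basis_vec k) (br (basis_vec j) (basis_vec l))))"

text \<open>
  The 1-cocycle condition, with \<open>[\<delta>(X), 1 \<otimes> Y + Y \<otimes> 1]\<close> written as \<open>- [1 \<otimes> Y + Y \<otimes> 1, \<delta>(X)]\<close>.
\<close>

definition cocycle ::
  "(real^'n \<Rightarrow> real^'n \<Rightarrow> real^'n) \<Rightarrow> (real^'n::finite \<Rightarrow> real^'n^'n) \<Rightarrow> bool" where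
  "cocycle br \<delta> \<longleftrightarrow> (\<forall>X Y. \<delta> (br X Y) = - ad2 br Y (\<delta> X) + ad2 br X (\<delta> Y))"

text \<open>
  The dual map on \<open>g\<^sup>*\<close>, the space of (automatically bounded) linear functionals:
  \<open>dual_bracket \<delta> \<phi> \<psi> = (\<phi> \<otimes> \<psi>) \<circ> \<delta>\<close>.  \<open>Blinfun\<close> is meaningful here because \<open>\<delta>\<close> is linear
  wherever the definition is used.
\<close>

definition dual_bracket ::
  "(real^'n::finite \<Rightarrow> real^'n^'n) \<Rightarrow>
   ((real^'n) \<Rightarrow>\<^sub>L real) \<Rightarrow> ((real^'n) \<Rightarrow>\<^sub>L real) \<Rightarrow> ((real^'n) \<Rightarrow>\<^sub>L real)" where
  "dual_bracket \<delta> \<phi> \<psi> =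
     Blinfun (\<lambda>X. \<Sum>i\<in>UNIV. \<Sum>j\<in>UNIV.
       \<delta> X $ i $ j * (blinfun_apply \<phi> (basis_vec i) * blinfun_apply \<psi> (basis_vec j)))"

definition lie_bialgebra ::
  "(real^'n \<Rightarrow> real^'n \<Rightarrow> real^'n) \<Rightarrow> (real^'n::finite \<Rightarrow> real^'n^'n) \<Rightarrow> bool" where
  "lie_bialgebra br \<delta> \<longleftrightarrow>
     lie_bracket br \<and> linear \<delta> \<and> cocycle br \<delta> \<and> lie_bracket (dual_bracket \<delta>)"

definition coboundary ::
  "(real^'n \<Rightarrow> real^'n \<Rightarrow> real^'n) \<Rightarrow> real^'n::finite^'n \<Rightarrow> (real^'n \<Rightarrow> real^'n^'n)" where
  "coboundary br r = (\<lambda>X. ad2 br X r)"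

definition coboundary_lie_bialgebra ::
  "(real^'n \<Rightarrow> real^'n \<Rightarrow> real^'n) \<Rightarrow> real^'n::finite^'n \<Rightarrow> bool" where
  "coboundary_lie_bialgebra br r \<longleftrightarrow> skew_symmetric r \<and> lie_bialgebra br (coboundary br r)"

definition nonstandard ::
  "(real^'n \<Rightarrow> real^'n \<Rightarrow> real^'n) \<Rightarrow> real^'n::finite^'n \<Rightarrow> bool" where
  "nonstandard br r \<longleftrightarrow> coboundary_lie_bialgebra br r \<and> schouten br r = 0"

definition standard ::
  "(real^'n \<Rightarrow> real^'n \<Rightarrow> real^'n) \<Rightarrow> real^'n::finite^'n \<Rightarrow> bool" where
  "standard br r \<longleftrightarrow>
     coboundary_lie_bialgebra br r \<and> schouten br r \<noteq> 0 \<and> ad_invariant3 br (schouten br r)"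

definition primitive :: "(real^'n \<Rightarrow> real^'n^'n) \<Rightarrow> real^'n \<Rightarrow> bool" where
  "primitive \<delta> X \<longleftrightarrow> \<delta> X = 0"


section \<open>The centrally extended (1+1)-dimensional Schroedinger algebra\<close>

datatype gen = iD | iH | iP | iK | iC | iM

lemma UNIV_gen: "UNIV = {iD, iH, iP, iK, iC, iM}"
  using gen.exhaust by auto

instance gen :: finite
  by standard (simp add: UNIV_gen)

type_synonym schr = "real^gen"

definition gD :: schr where "gD = basis_vec iD"
definition gH :: schr where "gH = basis_vec iH"
definition gP :: schr where "gP = basis_vec iP"
definition gK :: schr where "gK = basis_vec iK"
definition gC :: schr where "gC = basis_vec iC"
definition gM :: schr where "gM = basis_vec iM"

text \<open>
  Each unordered pair of distinct generators is listed in one order only; \<open>S_bracket\<close> below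
  antisymmetrizes.  The last clause covers the central element, the diagonal and the
  reversed pairs.
\<close>

fun S_table :: "gen \<Rightarrow> gen \<Rightarrow> schr" where
  "S_table iD iP = - gP"
| "S_table iD iK = gK"
| "S_table iK iP = gM"
| "S_table iD iH = (-2) *\<^sub>R gH"
| "S_table iD iC = 2 *\<^sub>R gC"
| "S_table iH iC = gD"
| "S_table iK iH = gP"
| "S_table iK iC = 0"
| "S_table iP iC = - gK"
| "S_table iP iH = 0"
| "S_table _ _ = 0"

definition S_bracket :: "schr \<Rightarrow> schr \<Rightarrow> schr" where
  "S_bracket X Y =
     (\<Sum>i\<in>UNIV. \<Sum>j\<in>UNIV. (X $ i * Y $ j) *\<^sub>R (S_table i j - S_table j i))"

lemma sum_UNIV_gen:
  fixes f :: "gen \<Rightarrow> 'a::comm_monoid_add"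
  shows "sum f UNIV = f iD + f iH + f iP + f iK + f iC + f iM"
  by (simp add: UNIV_gen add.assoc)

lemma S_bracket_table:
  "S_bracket gD gP = - gP"
  "S_bracket gD gK = gK"
  "S_bracket gK gP = gM"
  "S_bracket gD gH = (-2) *\<^sub>R gH"
  "S_bracket gD gC = 2 *\<^sub>R gC"
  "S_bracket gH gC = gD"
  "S_bracket gK gH = gP"
  "S_bracket gK gC = 0"
  "S_bracket gP gC = - gK"
  "S_bracket gP gH = 0"
  "S_bracket gM X = 0"
  by (simp_all add: S_bracket_def sum_UNIV_gen gD_def gH_def gP_def gK_def gC_def gM_def axis_def)

lemma S_bracket_components:
  "S_bracket X Y $ iD = X $ iH * Y $ iC - X $ iC * Y $ iH"
  "S_bracket X Y $ iH = 2 * (X $ iH * Y $ iD - X $ iD * Y $ iH)"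
  "S_bracket X Y $ iP = X $ iP * Y $ iD - X $ iD * Y $ iP + X $ iK * Y $ iH - X $ iH * Y $ iK"
  "S_bracket X Y $ iK = X $ iD * Y $ iK - X $ iK * Y $ iD + X $ iC * Y $ iP - X $ iP * Y $ iC"
  "S_bracket X Y $ iC = 2 * (X $ iD * Y $ iC - X $ iC * Y $ iD)"
  "S_bracket X Y $ iM = X $ iK * Y $ iP - X $ iP * Y $ iK"
  by (simp_all add: S_bracket_def sum_UNIV_gen gD_def gH_def gP_def gK_def gC_def gM_def axis_def
      algebra_simps)

lemma vec_eq_gen_iff:
  fixes x y :: "'a^gen"
  shows "x = y \<longleftrightarrow> x $ iD = y $ iD \<and> x $ iH = y $ iH \<and> x $ iP = y $ iP \<and>
    x $ iK = y $ iK \<and> x $ iC = y $ iC \<and> x $ iM = y $ iM"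
proof -
  have "(\<forall>k. Q k) \<longleftrightarrow> Q iD \<and> Q iH \<and> Q iP \<and> Q iK \<and> Q iC \<and> Q iM" for Q
    using gen.induct[of Q] by blast
  then show ?thesis by (simp add: vec_eq_iff)
qed

lemma lie_bracket_S: "lie_bracket S_bracket"
proof -
  have "bilinear S_bracket"
    unfolding bilinear_def
    by (intro conjI allI linearI; simp add: vec_eq_gen_iff S_bracket_components; simp add: algebra_simps)
  moreover have "S_bracket X X = 0" for X
    by (simp add: vec_eq_gen_iff S_bracket_components)
  moreover have "S_bracket X (S_bracket Y Z) + S_bracket Y (S_bracket Z X) + S_bracket Z (S_bracket X Y) = 0"
    for X Y Z
    unfolding vec_eq_gen_iff vector_add_component zero_index S_bracket_components
    by (intro conjI; algebra)
  ultimately show ?thesis by (simp add: lie_bracket_def)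
qed

end

theory Submission
  imports Defs
begin

text \<open>
  The adjoint action of \<open>D\<close> is diagonal on the generators.  Subtracting from a cocycle \<open>\<delta>\<close> a coboundary
  that absorbs the components of \<open>\<delta>(D)\<close> of nonzero weight leaves a cocycle whose value at \<open>D\<close> is
  ad-invariant, hence zero, and which therefore preserves weights; the few weight-preserving cocycles
  are coboundaries by inspection.  So \<open>\<delta>(X) = [1 \<otimes> X + X \<otimes> 1, r]\<close> for some skew \<open>r\<close>, and \<open>X\<close> is primitive
  iff \<open>r\<close> is \<open>X\<close>-invariant.  This linear condition together with a few components of the co-Jacobi
  identity gives the three lists.  All matrices \<open>r\<close> in these lists lie in one eight-parameter family,
  on which \<open>[[r, r]]\<close> is a multiple of the invariant tensor \<open>P \<and> K \<and> M\<close>.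
\<close>

section \<open>Adjoint actions, cocycles and the dual bracket in coordinates\<close>

lemma sum_axis_one_mult:
  fixes f :: "'n::finite \<Rightarrow> real"
  shows "(\<Sum>i\<in>UNIV. f i * axis i 1 $ p) = f p" "(\<Sum>i\<in>UNIV. axis i 1 $ p * f i) = f p"
  by (simp_all add: axis_def if_distrib[of "\<lambda>x. _ * x"] if_distrib[of "\<lambda>x. x * _"] cong: if_cong)

lemma linear_component_sum:
  fixes f :: "real^'n::finite \<Rightarrow> real^'m::finite"
  assumes "linear f"
  shows "f x $ p = (\<Sum>i\<in>UNIV. x $ i * f (basis_vec i) $ p)"
proof -
  have "f x = f (\<Sum>i\<in>UNIV. x $ i *\<^sub>R basis_vec i)"
    by (simp add: basis_expansion scalar_mult_eq_scaleR[symmetric])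
  then show ?thesis
    using assms by (simp add: linear_sum linear_scale)
qed

text \<open>The Kronecker deltas of the basis tensors collapse the double sum, leaving brackets of
  \<open>X\<close> with a row and a column of \<open>t\<close>. Together with a closed formula for
  the bracket this makes every entry computable by rewriting.\<close>

lemma ad2_component:
  assumes "linear (br X)"
  shows "ad2 br X t $ p $ q = br X (row p t) $ q + br X (column q t) $ p"
proof -
  have "ad2 br X t $ p $ q =
      (\<Sum>i\<in>UNIV. \<Sum>j\<in>UNIV. (t $ i $ j * br X (basis_vec j) $ q) * axis i 1 $ p) +
      (\<Sum>i\<in>UNIV. \<Sum>j\<in>UNIV. (t $ i $ j * br X (basis_vec i) $ p) * axis j 1 $ q)"
    by (simp add: ad2_def tensor2_def algebra_simps sum.distrib)
  also have "\<dots> = (\<Sum>j\<in>UNIV. t $ p $ j * br X (basis_vec j) $ q) +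
      (\<Sum>i\<in>UNIV. t $ i $ q * br X (basis_vec i) $ p)"
    by (subst sum.swap) (simp only: sum_axis_one_mult)
  also have "\<dots> = br X (row p t) $ q + br X (column q t) $ p"
    unfolding linear_component_sum[OF assms, of "row p t"] linear_component_sum[OF assms, of "column q t"]
    by (simp add: row_def column_def)
  finally show ?thesis .
qed

lemma ad3_component:
  assumes "linear (br X)"
  shows "ad3 br X t $ p $ q $ s =
    br X (\<chi> i. t $ i $ q $ s) $ p + br X (\<chi> j. t $ p $ j $ s) $ q + br X (\<chi> k. t $ p $ q $ k) $ s"
proof -
  have "ad3 br X t $ p $ q $ s =
      (\<Sum>i\<in>UNIV. \<Sum>j\<in>UNIV. \<Sum>k\<in>UNIV. (t $ i $ j $ k * br X (basis_vec i) $ p * axis j 1 $ q) * axis k 1 $ s) +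
      (\<Sum>i\<in>UNIV. \<Sum>j\<in>UNIV. \<Sum>k\<in>UNIV. (t $ i $ j $ k * br X (basis_vec j) $ q * axis i 1 $ p) * axis k 1 $ s) +
      (\<Sum>i\<in>UNIV. \<Sum>j\<in>UNIV. \<Sum>k\<in>UNIV. (t $ i $ j $ k * br X (basis_vec k) $ s * axis i 1 $ p) * axis j 1 $ q)"
    by (simp add: ad3_def tensor3_def algebra_simps sum.distrib)
  also have "\<dots> = (\<Sum>i\<in>UNIV. t $ i $ q $ s * br X (basis_vec i) $ p) +
      (\<Sum>j\<in>UNIV. t $ p $ j $ s * br X (basis_vec j) $ q) +
      (\<Sum>k\<in>UNIV. t $ p $ q $ k * br X (basis_vec k) $ s)"
  proof -
    have *: "(\<Sum>i\<in>UNIV. \<Sum>j\<in>UNIV. f i j * axis i 1 $ p) = (\<Sum>j\<in>UNIV. f p j)"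
      for f :: "'a \<Rightarrow> 'a \<Rightarrow> real" and p
      by (subst sum.swap) (simp only: sum_axis_one_mult)
    have **: "(\<Sum>i\<in>UNIV. \<Sum>j\<in>UNIV. \<Sum>k\<in>UNIV. f i j k * axis j 1 $ p) =
        (\<Sum>i\<in>UNIV. \<Sum>k\<in>UNIV. f i p k)"
      for f :: "'a \<Rightarrow> 'a \<Rightarrow> 'a \<Rightarrow> real" and p
      by (simp only: *)
    show ?thesis by (simp only: ** * sum_axis_one_mult)
  qed
  also have "\<dots> = br X (\<chi> i. t $ i $ q $ s) $ p + br X (\<chi> j. t $ p $ j $ s) $ q + br X (\<chi> k. t $ p $ q $ k) $ s"
    unfolding linear_component_sum[OF assms, of "\<chi> i. t $ i $ q $ s"]
      linear_component_sum[OF assms, of "\<chi> j. t $ p $ j $ s"]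
      linear_component_sum[OF assms, of "\<chi> k. t $ p $ q $ k"]
    by simp
  finally show ?thesis .
qed

lemma bilinear_component_sum:
  fixes f :: "real^'n::finite \<Rightarrow> real^'n \<Rightarrow> real^'m::finite"
  assumes "bilinear f"
  shows "f x y $ p = (\<Sum>i\<in>UNIV. \<Sum>j\<in>UNIV. x $ i * y $ j * f (basis_vec i) (basis_vec j) $ p)"
proof -
  have l: "linear (\<lambda>x. f x y)" "linear (f x)" for x y
    using assms by (simp_all add: bilinear_def)
  show ?thesis
    unfolding linear_component_sum[OF l(1), of x]
    unfolding linear_component_sum[OF l(2), of _ y]
    by (simp add: sum_distrib_left mult.assoc)
qed

text \<open>In each of the three summands two of the four indices sit in unbracketed tensor slots
  and are fixed by the entry. The remaining two are contracted by bilinearity into one bracket of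
  rows or columns of \<open>r\<close>.\<close>

lemma schouten_component:
  assumes "bilinear br"
  shows "schouten br r $ p $ q $ s =
    br (column q r) (column s r) $ p + br (row p r) (column s r) $ q + br (row p r) (row q r) $ s"
proof -
  let ?e = basis_vec
  have *: "(\<Sum>i\<in>UNIV. \<Sum>j\<in>UNIV. f i j * axis i 1 $ p) = (\<Sum>j\<in>UNIV. f p j)"
    for f :: "'a \<Rightarrow> 'a \<Rightarrow> real" and p
    by (subst sum.swap) (simp only: sum_axis_one_mult)
  have **: "(\<Sum>i\<in>UNIV. \<Sum>j\<in>UNIV. \<Sum>k\<in>UNIV. f i j k * axis i 1 $ p) = (\<Sum>j\<in>UNIV. \<Sum>k\<in>UNIV. f p j k)"
    for f :: "'a \<Rightarrow> 'a \<Rightarrow> 'a \<Rightarrow> real" and p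
    by (subst sum.swap) (simp only: *)
  have ***: "(\<Sum>i\<in>UNIV. \<Sum>j\<in>UNIV. \<Sum>k\<in>UNIV. \<Sum>l\<in>UNIV. f i j k l * axis i 1 $ p) =
      (\<Sum>j\<in>UNIV. \<Sum>k\<in>UNIV. \<Sum>l\<in>UNIV. f p j k l)"
    for f :: "'a \<Rightarrow> 'a \<Rightarrow> 'a \<Rightarrow> 'a \<Rightarrow> real" and p
    by (subst sum.swap) (simp only: **)
  have "schouten br r $ p $ q $ s =
      (\<Sum>i\<in>UNIV. \<Sum>j\<in>UNIV. \<Sum>k\<in>UNIV. \<Sum>l\<in>UNIV.
        (r $ i $ j * r $ k $ l * br (?e i) (?e k) $ p * axis j 1 $ q) * axis l 1 $ s) +
      (\<Sum>i\<in>UNIV. \<Sum>j\<in>UNIV. \<Sum>k\<in>UNIV. \<Sum>l\<in>UNIV.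
        (r $ i $ j * r $ k $ l * br (?e j) (?e k) $ q * axis i 1 $ p) * axis l 1 $ s) +
      (\<Sum>i\<in>UNIV. \<Sum>j\<in>UNIV. \<Sum>k\<in>UNIV. \<Sum>l\<in>UNIV.
        (r $ i $ j * r $ k $ l * br (?e j) (?e l) $ s * axis k 1 $ q) * axis i 1 $ p)"
    by (simp add: schouten_def tensor3_def algebra_simps sum.distrib)
  also have "\<dots> =
      (\<Sum>i\<in>UNIV. \<Sum>k\<in>UNIV. r $ i $ q * r $ k $ s * br (?e i) (?e k) $ p) +
      (\<Sum>j\<in>UNIV. \<Sum>k\<in>UNIV. r $ p $ j * r $ k $ s * br (?e j) (?e k) $ q) +
      (\<Sum>j\<in>UNIV. \<Sum>l\<in>UNIV. r $ p $ j * r $ q $ l * br (?e j) (?e l) $ s)"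
    by (simp only: sum_axis_one_mult * ** ***)
  also have "\<dots> = br (column q r) (column s r) $ p + br (row p r) (column s r) $ q +
      br (row p r) (row q r) $ s"
    unfolding bilinear_component_sum[OF assms, of "row p r"]
      bilinear_component_sum[OF assms, of "column q r"]
    by (simp add: row_def column_def)
  finally show ?thesis .
qed

lemma lie_bracket_anticommute:
  assumes "lie_bracket br"
  shows "br x y = - br y x"
proof -
  have bil: "bilinear br" and alt: "\<And>x. br x x = 0"
    using assms by (auto simp: lie_bracket_def)
  have "br (x + y) (x + y) = br x x + br x y + (br y x + br y y)"
    by (simp add: bilinear_ladd[OF bil] bilinear_radd[OF bil])
  then show ?thesis
    by (simp add: alt eq_neg_iff_add_eq_0)
qed

text \<open>In matrix form \<open>X\<close> acts by \<open>A ** t + t ** transpose A\<close>, where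
  \<open>A\<close> is the matrix of \<open>br X\<close>. The Jacobi identity says that
  \<open>br X Y\<close> has the commutator as its matrix, and the mixed terms with one factor on
  each side of \<open>t\<close> cancel in the difference.\<close>

lemma ad2_bracket:
  fixes br :: "real^'n::finite \<Rightarrow> real^'n \<Rightarrow> real^'n"
  assumes "lie_bracket br"
  shows "ad2 br (br X Y) t = ad2 br X (ad2 br Y t) - ad2 br Y (ad2 br X t)"
proof -
  have bil: "bilinear br" and jac: "br x (br y z) + br y (br z x) + br z (br x y) = 0" for x y z
    using assms by (auto simp: lie_bracket_def)
  have lin: "linear (br X)" for X
    using bil by (simp add: bilinear_def)
  have mat: "ad2 br X t = matrix (br X) ** t + t ** transpose (matrix (br X))" for X t
    unfolding vec_eq_iff ad2_component[where br=br, OF lin] linear_component_sum[OF lin, of _ "row _ _"]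
      linear_component_sum[OF lin, of _ "column _ _"]
    by (simp add: matrix_matrix_mult_def transpose_def matrix_def row_def column_def mult.commute)
  have skew: "br x y = - br y x" for x y
    using lie_bracket_anticommute[OF assms] .
  have "br (br X Y) z = br X (br Y z) - br Y (br X z)" for z
    using jac[of X Y z] skew[of z "br X Y"] skew[of z X] bilinear_rneg[OF bil, of Y "br X z"]
    by (simp add: algebra_simps eq_neg_iff_add_eq_0)
  then have "br (br X Y) z = (br X \<circ> br Y) z - (br Y \<circ> br X) z" for z
    by simp
  then have "matrix (br (br X Y)) = matrix (br X \<circ> br Y) - matrix (br Y \<circ> br X)"
    by (simp add: matrix_def vec_eq_iff)
  also have "\<dots> = matrix (br X) ** matrix (br Y) - matrix (br Y) ** matrix (br X)"
    by (simp add: matrix_compose[OF lin lin])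
  finally have comm: "matrix (br (br X Y)) = matrix (br X) ** matrix (br Y) - matrix (br Y) ** matrix (br X)" .
  have transpose_diff: "transpose (A - B) = transpose A - transpose B" for A B :: "real^'n^'n"
    by (simp add: transpose_def vec_eq_iff)
  have mult_diff: "(A - B) ** T = A ** T - B ** T" "T ** (A - B) = T ** A - T ** B"
    for A B T :: "real^'n^'n"
    by (simp_all add: matrix_matrix_mult_def vec_eq_iff left_diff_distrib right_diff_distrib sum_subtractf)
  have mult_add: "(A + B) ** T = A ** T + B ** T" for A B T :: "real^'n^'n"
    by (simp add: matrix_matrix_mult_def vec_eq_iff distrib_right sum.distrib)
  show ?thesis
    unfolding mat comm transpose_diff matrix_transpose_mul mult_diff matrix_add_ldistrib mult_add matrix_mul_assoc
    by simp
qed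

section \<open>The Lie bracket on the dual and the co-Jacobi identity\<close>

lemma skew_symmetric_iff: "skew_symmetric r \<longleftrightarrow> (\<forall>i j. r $ i $ j = - r $ j $ i)"
  by (auto simp: skew_symmetric_def vec_eq_iff transpose_def)

text \<open>The coefficient at \<open>(i, j, k)\<close> of the sum of the cyclic permutations of (id
  \<otimes> \<delta>)(\<delta>(X)); its vanishing is the co-Jacobi identity.\<close>

definition co_jacobiator ::
  "(real^'n::finite \<Rightarrow> real^'n^'n) \<Rightarrow> real^'n \<Rightarrow> 'n \<Rightarrow> 'n \<Rightarrow> 'n \<Rightarrow> real" where
  "co_jacobiator \<delta> X i j k =
     (\<Sum>a\<in>UNIV. \<delta> X $ i $ a * \<delta> (basis_vec a) $ j $ k + \<delta> X $ j $ a * \<delta> (basis_vec a) $ k $ i +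
       \<delta> X $ k $ a * \<delta> (basis_vec a) $ i $ j)"

lemma dual_bracket_apply:
  assumes "linear \<delta>"
  shows "blinfun_apply (dual_bracket \<delta> \<phi> \<psi>) X =
    (\<Sum>i\<in>UNIV. \<Sum>j\<in>UNIV.
       \<delta> X $ i $ j * (blinfun_apply \<phi> (basis_vec i) * blinfun_apply \<psi> (basis_vec j)))"
proof -
  have "linear (\<lambda>X. \<Sum>i\<in>UNIV. \<Sum>j\<in>UNIV.
       \<delta> X $ i $ j * (blinfun_apply \<phi> (basis_vec i) * blinfun_apply \<psi> (basis_vec j)))"
    by (rule linearI)
      (simp_all add: linear_add[OF assms] linear_scale[OF assms] sum.distrib sum_distrib_left algebra_simps)
  then show ?thesis
    unfolding dual_bracket_def by (simp add: bounded_linear_Blinfun_apply linear_conv_bounded_linear)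
qed

text \<open>The functionals \<open>blinfun_inner_right (basis_vec i)\<close> form the dual basis, so
  pairing with them extracts single entries of \<delta>(X).\<close>

lemma dual_bracket_coordinates:
  assumes "linear \<delta>"
  shows "blinfun_apply (dual_bracket \<delta> (blinfun_inner_right (basis_vec i)) \<psi>) X =
      (\<Sum>j\<in>UNIV. \<delta> X $ i $ j * blinfun_apply \<psi> (basis_vec j))"
    and "blinfun_apply (dual_bracket \<delta> (blinfun_inner_right (basis_vec i)) (blinfun_inner_right (basis_vec j))) X =
      \<delta> X $ i $ j"
proof -
  have coord: "blinfun_apply (blinfun_inner_right (basis_vec i)) (basis_vec p) = axis p 1 $ i"
    for i p :: 'a
    by (simp add: inner_axis')
  show *: "blinfun_apply (dual_bracket \<delta> (blinfun_inner_right (basis_vec i)) \<psi>) X =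
      (\<Sum>j\<in>UNIV. \<delta> X $ i $ j * blinfun_apply \<psi> (basis_vec j))" for \<psi>
    unfolding dual_bracket_apply[OF assms] coord
    by (subst sum.swap) (simp add: mult.left_commute[of _ "axis _ _ $ _"] sum_axis_one_mult)
  show "blinfun_apply (dual_bracket \<delta> (blinfun_inner_right (basis_vec i)) (blinfun_inner_right (basis_vec j))) X =
      \<delta> X $ i $ j"
    unfolding * coord by (rule sum_axis_one_mult)
qed

lemma dual_bracket_dual_bracket_apply:
  assumes "linear \<delta>"
  shows "blinfun_apply (dual_bracket \<delta> \<phi> (dual_bracket \<delta> \<psi> \<theta>)) X =
    (\<Sum>i\<in>UNIV. \<Sum>j\<in>UNIV. \<Sum>k\<in>UNIV. (\<Sum>a\<in>UNIV. \<delta> X $ i $ a * \<delta> (basis_vec a) $ j $ k) *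
       (blinfun_apply \<phi> (basis_vec i) * blinfun_apply \<psi> (basis_vec j) * blinfun_apply \<theta> (basis_vec k)))"
proof -
  have "blinfun_apply (dual_bracket \<delta> \<phi> (dual_bracket \<delta> \<psi> \<theta>)) X =
    (\<Sum>i\<in>UNIV. \<Sum>a\<in>UNIV. \<Sum>j\<in>UNIV. \<Sum>k\<in>UNIV. \<delta> X $ i $ a * \<delta> (basis_vec a) $ j $ k *
       (blinfun_apply \<phi> (basis_vec i) * blinfun_apply \<psi> (basis_vec j) * blinfun_apply \<theta> (basis_vec k)))"
    by (simp add: dual_bracket_apply[OF assms] sum_distrib_left sum_distrib_right mult_ac)
  also have "\<dots> = (\<Sum>i\<in>UNIV. \<Sum>j\<in>UNIV. \<Sum>k\<in>UNIV. \<Sum>a\<in>UNIV. \<delta> X $ i $ a * \<delta> (basis_vec a) $ j $ k *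
       (blinfun_apply \<phi> (basis_vec i) * blinfun_apply \<psi> (basis_vec j) * blinfun_apply \<theta> (basis_vec k)))"
    by (subst (2) sum.swap, subst (3) sum.swap) (rule refl)
  finally show ?thesis
    by (simp add: sum_distrib_right)
qed

text \<open>The three nested brackets give the same array contracted with cyclically permuted
  functionals. Rotating the summation indices moves the permutation from the functionals to the
  array.\<close>

lemma dual_bracket_jacobi_sum:
  assumes "linear \<delta>"
  shows "blinfun_apply (dual_bracket \<delta> \<phi> (dual_bracket \<delta> \<psi> \<theta>) + dual_bracket \<delta> \<psi> (dual_bracket \<delta> \<theta> \<phi>) +
      dual_bracket \<delta> \<theta> (dual_bracket \<delta> \<phi> \<psi>)) X =
    (\<Sum>i\<in>UNIV. \<Sum>j\<in>UNIV. \<Sum>k\<in>UNIV. co_jacobiator \<delta> X i j k *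
       (blinfun_apply \<phi> (basis_vec i) * blinfun_apply \<psi> (basis_vec j) * blinfun_apply \<theta> (basis_vec k)))"
proof -
  define N where "N i j k = (\<Sum>a\<in>UNIV. \<delta> X $ i $ a * \<delta> (basis_vec a) $ j $ k)" for i j k
  have J: "co_jacobiator \<delta> X i j k = N i j k + N j k i + N k i j" for i j k
    by (simp add: co_jacobiator_def N_def sum.distrib)
  have rot: "(\<Sum>i\<in>UNIV. \<Sum>j\<in>UNIV. \<Sum>k\<in>UNIV. f i j k) = (\<Sum>j\<in>UNIV. \<Sum>k\<in>UNIV. \<Sum>i\<in>UNIV. f i j k)"
    for f :: "'a \<Rightarrow> 'a \<Rightarrow> 'a \<Rightarrow> real"
    by (subst sum.swap, subst (2) sum.swap) (rule refl)
  show ?thesis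
    unfolding plus_blinfun.rep_eq dual_bracket_dual_bracket_apply[OF assms] J N_def[symmetric] distrib_right sum.distrib
    by (subst (2) rot[symmetric], subst (3) rot) (simp add: mult_ac)
qed

text \<open>Left to right, both identities are evaluated on the dual basis. Right to left, the
  contraction formulas extend them from entries to arbitrary functionals.\<close>

lemma lie_bracket_dual_iff:
  fixes \<delta> :: "real^'n::finite \<Rightarrow> real^'n^'n"
  assumes "linear \<delta>"
  shows "lie_bracket (dual_bracket \<delta>) \<longleftrightarrow>
    (\<forall>X. skew_symmetric (\<delta> X)) \<and> (\<forall>X i j k. co_jacobiator \<delta> X i j k = 0)"
proof
  assume lie: "lie_bracket (dual_bracket \<delta>)"
  have skew: "\<delta> X $ i $ j = - \<delta> X $ j $ i" for X i j
    using arg_cong[OF lie_bracket_anticommute[OF lie, of "blinfun_inner_right (basis_vec i)"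
        "blinfun_inner_right (basis_vec j)"], of "\<lambda>f. blinfun_apply f X"]
    by (simp add: dual_bracket_coordinates(2)[OF assms] uminus_blinfun.rep_eq)
  moreover have "co_jacobiator \<delta> X i j k = 0" for X i j k
  proof -
    let ?e = "\<lambda>i. blinfun_inner_right (basis_vec i)"
    have "dual_bracket \<delta> (?e i) (dual_bracket \<delta> (?e j) (?e k)) + dual_bracket \<delta> (?e j) (dual_bracket \<delta> (?e k) (?e i)) +
      dual_bracket \<delta> (?e k) (dual_bracket \<delta> (?e i) (?e j)) = 0"
      using lie by (simp add: lie_bracket_def)
    from arg_cong[OF this, of "\<lambda>f. blinfun_apply f X"] show ?thesis
      by (simp add: dual_bracket_coordinates(1)[OF assms, of _ "dual_bracket \<delta> _ _"]
        dual_bracket_coordinates(2)[OF assms] plus_blinfun.rep_eq co_jacobiator_def sum.distrib)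
  qed
  ultimately show "(\<forall>X. skew_symmetric (\<delta> X)) \<and> (\<forall>X i j k. co_jacobiator \<delta> X i j k = 0)"
    unfolding skew_symmetric_iff by blast
next
  assume *: "(\<forall>X. skew_symmetric (\<delta> X)) \<and> (\<forall>X i j k. co_jacobiator \<delta> X i j k = 0)"
  have "bilinear (dual_bracket \<delta>)"
    unfolding bilinear_def
    by (intro conjI allI linearI blinfun_eqI)
      (simp_all add: dual_bracket_apply[OF assms] plus_blinfun.rep_eq scaleR_blinfun.rep_eq
        sum.distrib sum_distrib_left algebra_simps)
  moreover have "dual_bracket \<delta> \<phi> \<phi> = 0" for \<phi>
  proof (rule blinfun_eqI)
    fix X
    let ?f = "\<lambda>i j. \<delta> X $ i $ j * (blinfun_apply \<phi> (basis_vec i) * blinfun_apply \<phi> (basis_vec j))"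
    have "?f i j = - ?f j i" for i j
      using * by (metis skew_symmetric_iff mult.commute mult_minus_left)
    \<comment> \<open>A skew array summed over all index pairs equals its own negative, hence is
      zero.\<close>
    then have "(\<Sum>i\<in>UNIV. \<Sum>j\<in>UNIV. ?f i j) = (\<Sum>i\<in>UNIV. \<Sum>j\<in>UNIV. - ?f j i)"
      by (intro sum.cong refl)
    also have "\<dots> = - (\<Sum>i\<in>UNIV. \<Sum>j\<in>UNIV. ?f j i)"
      by (simp only: sum_negf)
    also have "(\<Sum>i\<in>UNIV. \<Sum>j\<in>UNIV. ?f j i) = (\<Sum>i\<in>UNIV. \<Sum>j\<in>UNIV. ?f i j)"
      by (rule sum.swap)
    finally show "blinfun_apply (dual_bracket \<delta> \<phi> \<phi>) X = blinfun_apply 0 X"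
      by (simp add: dual_bracket_apply[OF assms])
  qed
  moreover have "dual_bracket \<delta> \<phi> (dual_bracket \<delta> \<psi> \<theta>) + dual_bracket \<delta> \<psi> (dual_bracket \<delta> \<theta> \<phi>) +
      dual_bracket \<delta> \<theta> (dual_bracket \<delta> \<phi> \<psi>) = 0" for \<phi> \<psi> \<theta>
    using * by (intro blinfun_eqI) (simp add: dual_bracket_jacobi_sum[OF assms])
  ultimately show "lie_bracket (dual_bracket \<delta>)"
    by (simp add: lie_bracket_def)
qed

section \<open>Coboundaries over a general Lie algebra\<close>

lemma ad2_add: "ad2 br X (s + t) = ad2 br X s + ad2 br X t"
  by (simp add: ad2_def algebra_simps sum.distrib)

lemma ad2_scaleR: "ad2 br X (c *\<^sub>R t) = c *\<^sub>R ad2 br X t"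
  by (simp add: ad2_def scaleR_sum_right)

lemma ad2_diff: "ad2 br X (s - t) = ad2 br X s - ad2 br X t"
  using ad2_add[of br X s "- t"] ad2_scaleR[of br X "-1" t] by simp

lemma linear_coboundary:
  assumes "bilinear br"
  shows "linear (coboundary br r)"
proof -
  have lin: "linear (br X)" for X
    using assms by (simp add: bilinear_def)
  show ?thesis
    by (rule linearI)
      (simp_all add: coboundary_def vec_eq_iff ad2_component[where br=br, OF lin]
        bilinear_ladd[OF assms] bilinear_lmul[OF assms] algebra_simps)
qed

text \<open>For X \<mapsto> ad X r the cocycle condition is the representation property
  \<open>ad2_bracket\<close>.\<close>

lemma cocycle_coboundary:
  assumes "lie_bracket br"
  shows "cocycle br (coboundary br r)"
  by (simp add: cocycle_def coboundary_def ad2_bracket[OF assms])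

lemma row_component: "row i t $ j = t $ i $ j"
  by (simp add: row_def)

lemma column_component: "column j t $ i = t $ i $ j"
  by (simp add: column_def)

lemma skew_symmetric_ad2:
  assumes "linear (br X)" "skew_symmetric r"
  shows "skew_symmetric (ad2 br X r)"
proof -
  have "r $ i $ j = - r $ j $ i" for i j
    using assms(2) unfolding skew_symmetric_iff by blast
  then have "column q r = - row q r" for q
    unfolding vec_eq_iff by (metis row_component column_component vector_uminus_component)
  then show ?thesis
    unfolding skew_symmetric_iff ad2_component[where br=br, OF assms(1)]
    by (simp add: linear_neg[OF assms(1)])
qed

text \<open>Coboundaries are linear cocycles, and a skew \<open>r\<close> gives skew values, so the
  co-Jacobi identity is what remains to be checked.\<close>

lemma coboundary_lie_bialgebra_iff:
  assumes "lie_bracket br"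
  shows "coboundary_lie_bialgebra br r \<longleftrightarrow>
    skew_symmetric r \<and> (\<forall>X i j k. co_jacobiator (coboundary br r) X i j k = 0)"
proof -
  have bil: "bilinear br"
    using assms by (simp add: lie_bracket_def)
  then have "linear (br X)" for X
    by (simp add: bilinear_def)
  then have "skew_symmetric r \<Longrightarrow> skew_symmetric (coboundary br r X)" for X
    using skew_symmetric_ad2[of br X r] by (simp add: coboundary_def)
  then show ?thesis
    using assms by (auto simp: coboundary_lie_bialgebra_def lie_bialgebra_def
        linear_coboundary[OF bil] cocycle_coboundary lie_bracket_dual_iff)
qed

section \<open>Cocycles of the Schroedinger algebra are coboundaries\<close>

lemma linear_S_bracket [simp]: "linear (S_bracket X)"
  using lie_bracket_S by (simp add: lie_bracket_def bilinear_def)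

lemma bilinear_S_bracket: "bilinear S_bracket"
  using lie_bracket_S by (simp add: lie_bracket_def)

lemmas ad2_S_component = ad2_component[where br = S_bracket, OF linear_S_bracket]
lemmas ad3_S_component = ad3_component[where br = S_bracket, OF linear_S_bracket]
lemmas schouten_S_component = schouten_component[OF bilinear_S_bracket]

lemma gen_components [simp]:
  "gD $ iD = 1" "gD $ iH = 0" "gD $ iP = 0" "gD $ iK = 0" "gD $ iC = 0" "gD $ iM = 0"
  "gH $ iD = 0" "gH $ iH = 1" "gH $ iP = 0" "gH $ iK = 0" "gH $ iC = 0" "gH $ iM = 0"
  "gP $ iD = 0" "gP $ iH = 0" "gP $ iP = 1" "gP $ iK = 0" "gP $ iC = 0" "gP $ iM = 0"
  "gK $ iD = 0" "gK $ iH = 0" "gK $ iP = 0" "gK $ iK = 1" "gK $ iC = 0" "gK $ iM = 0"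
  "gC $ iD = 0" "gC $ iH = 0" "gC $ iP = 0" "gC $ iK = 0" "gC $ iC = 1" "gC $ iM = 0"
  "gM $ iD = 0" "gM $ iH = 0" "gM $ iP = 0" "gM $ iK = 0" "gM $ iC = 0" "gM $ iM = 1"
  by (simp_all add: gD_def gH_def gP_def gK_def gC_def gM_def axis_def)

lemma wedge_component: "(x \<and>\<^sub>t y) $ i $ j = x $ i * y $ j - y $ i * x $ j"
  by (simp add: wedge_def tensor2_def)

lemmas S_components = S_bracket_components row_component column_component

text \<open>As rewrite rules these express every entry by the 15 entries above the diagonal, in the
  order D, H, P, K, C, M. The general skewness equation would loop as a rewrite rule.\<close>

lemma skew_symmetric_gen:
  assumes "skew_symmetric (t :: real^gen^gen)"
  shows "t $ iD $ iD = 0" "t $ iH $ iH = 0" "t $ iP $ iP = 0" "t $ iK $ iK = 0" "t $ iC $ iC = 0"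
    "t $ iM $ iM = 0" "t $ iH $ iD = - t $ iD $ iH" "t $ iP $ iD = - t $ iD $ iP"
    "t $ iK $ iD = - t $ iD $ iK" "t $ iC $ iD = - t $ iD $ iC" "t $ iM $ iD = - t $ iD $ iM"
    "t $ iP $ iH = - t $ iH $ iP" "t $ iK $ iH = - t $ iH $ iK" "t $ iC $ iH = - t $ iH $ iC"
    "t $ iM $ iH = - t $ iH $ iM" "t $ iK $ iP = - t $ iP $ iK" "t $ iC $ iP = - t $ iP $ iC"
    "t $ iM $ iP = - t $ iP $ iM" "t $ iC $ iK = - t $ iK $ iC" "t $ iM $ iK = - t $ iK $ iM"
    "t $ iM $ iC = - t $ iC $ iM"
proof -
  have skew: "t $ i $ j = - t $ j $ i" for i j
    using assms unfolding skew_symmetric_iff by blast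
  have "t $ i $ i = 0" for i
    using skew[of i i] by linarith
  then show "t $ iD $ iD = 0" "t $ iH $ iH = 0" "t $ iP $ iP = 0" "t $ iK $ iK = 0" "t $ iC $ iC = 0"
    "t $ iM $ iM = 0"
    by this+
  show "t $ iH $ iD = - t $ iD $ iH" "t $ iP $ iD = - t $ iD $ iP"
    "t $ iK $ iD = - t $ iD $ iK" "t $ iC $ iD = - t $ iD $ iC" "t $ iM $ iD = - t $ iD $ iM"
    "t $ iP $ iH = - t $ iH $ iP" "t $ iK $ iH = - t $ iH $ iK" "t $ iC $ iH = - t $ iH $ iC"
    "t $ iM $ iH = - t $ iH $ iM" "t $ iK $ iP = - t $ iP $ iK" "t $ iC $ iP = - t $ iP $ iC"
    "t $ iM $ iP = - t $ iP $ iM" "t $ iC $ iK = - t $ iK $ iC" "t $ iM $ iK = - t $ iK $ iM"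
    "t $ iM $ iC = - t $ iC $ iM"
    by (rule skew)+
qed

lemma linear_eq_on_gens:
  assumes "linear f" "linear f'" "f gD = f' gD" "f gH = f' gH" "f gP = f' gP" "f gK = f' gK"
    "f gC = f' gC" "f gM = f' gM"
  shows "f = f'"
proof -
  have "f (basis_vec a) = f' (basis_vec a)" for a
    using assms(3-) by (cases a) (simp_all add: gD_def gH_def gP_def gK_def gC_def gM_def)
  moreover have "\<exists>a. b = basis_vec a" if "b \<in> Basis" for b :: schr
    using that by (auto simp: Basis_vec_def)
  ultimately show ?thesis
    using assms(1,2) by (metis linear_eq_stdbasis)
qed

text \<open>The eigenvalue of ad D on each generator. It is real-valued because entries are later
  divided by sums of weights.\<close>

fun weight :: "gen \<Rightarrow> real" where
  "weight iD = 0"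
| "weight iH = - 2"
| "weight iP = - 1"
| "weight iK = 1"
| "weight iC = 2"
| "weight iM = 0"

lemma S_bracket_gD: "S_bracket gD X $ i = weight i * X $ i"
  by (cases i) (simp_all add: S_bracket_components)

lemma ad2_gD: "ad2 S_bracket gD t $ i $ j = (weight i + weight j) * t $ i $ j"
  by (simp add: ad2_S_component S_bracket_gD row_component column_component algebra_simps)

text \<open>Since \<open>[D, b]\<close> is \<open>weight b\<close> times \<open>b\<close>, the
  cocycle identity for the pair \<open>D\<close>, \<open>b\<close> determines from \<delta>(D) every
  entry of \<delta>(b) whose weight differs from that of \<open>b\<close>.\<close>

lemma cocycle_gD:
  assumes "linear \<delta>" "cocycle S_bracket \<delta>"
  shows "(weight i + weight j - weight b) * \<delta> (basis_vec b) $ i $ j =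
    ad2 S_bracket (basis_vec b) (\<delta> gD) $ i $ j"
proof -
  have "S_bracket gD (basis_vec b) = weight b *\<^sub>R basis_vec b"
    by (simp add: vec_eq_iff S_bracket_gD axis_def)
  then have "weight b *\<^sub>R \<delta> (basis_vec b) =
      - ad2 S_bracket (basis_vec b) (\<delta> gD) + ad2 S_bracket gD (\<delta> (basis_vec b))"
    using assms by (metis cocycle_def linear_scale)
  then have "(weight b *\<^sub>R \<delta> (basis_vec b)) $ i $ j =
      (- ad2 S_bracket (basis_vec b) (\<delta> gD) + ad2 S_bracket gD (\<delta> (basis_vec b))) $ i $ j"
    by simp
  then show ?thesis
    by (simp add: ad2_gD algebra_simps)
qed

lemma cocycle_weight_zero:
  assumes lin: "linear \<delta>" and coc: "cocycle S_bracket \<delta>" and skew: "\<And>X. skew_symmetric (\<delta> X)"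
    and D: "\<delta> gD = 0"
  obtains c1 c2 c3 where
    "\<delta> = coboundary S_bracket (c1 *\<^sub>R (gD \<and>\<^sub>t gM) + c2 *\<^sub>R (gP \<and>\<^sub>t gK) + c3 *\<^sub>R (gH \<and>\<^sub>t gC))"
proof -
  have Z: "weight i + weight j \<noteq> weight b \<Longrightarrow> \<delta> (basis_vec b) $ i $ j = 0" for i j b
    using cocycle_gD[OF lin coc, of i j b]
    by (simp add: D ad2_def)
  note zeros = Z[of _ _ iH, folded gH_def] Z[of _ _ iP, folded gP_def] Z[of _ _ iK, folded gK_def]
    Z[of _ _ iC, folded gC_def] Z[of _ _ iM, folded gM_def]
  note sk = skew_symmetric_gen[OF skew]
  have E: "\<delta> (S_bracket X Y) $ i $ j = - ad2 S_bracket Y (\<delta> X) $ i $ j + ad2 S_bracket X (\<delta> Y) $ i $ j"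
    for X Y i j
    using coc by (simp add: cocycle_def)
  note simps = S_bracket_table linear_0[OF lin] linear_neg[OF lin] ad2_S_component S_components sk zeros D
  \<comment> \<open>By weight, 13 entries above the diagonal may be nonzero. Single components of
    the cocycle identity on brackets of generators form a linear system that expresses ten of them
    by \<delta>(H) at \<open>(D, H)\<close> and \<open>(H, M)\<close> and \<delta>(P) at
    \<open>(P, M)\<close>.\<close>
  have "\<delta> gP $ iH $ iK = \<delta> gH $ iD $ iH" "\<delta> gP $ iD $ iP = 0"
    "\<delta> gK $ iP $ iC = - \<delta> gH $ iD $ iH" "\<delta> gK $ iD $ iK = 0"
    "\<delta> gK $ iK $ iM = \<delta> gP $ iP $ iM - \<delta> gH $ iH $ iM"
    "\<delta> gC $ iD $ iC = \<delta> gH $ iD $ iH" "\<delta> gC $ iC $ iM = - \<delta> gH $ iH $ iM"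
    "\<delta> gM $ iD $ iM = 0" "\<delta> gM $ iP $ iK = 0" "\<delta> gM $ iH $ iC = 0"
    using E[of gH gC iD iM] E[of gH gC iP iK] E[of gH gC iH iC]
      E[of gP gH iD iH] E[of gP gH iH iP] E[of gP gH iH iM]
      E[of gK gH iD iP] E[of gK gH iP iM] E[of gK gH iH iK]
      E[of gP gC iD iK] E[of gP gC iP iC] E[of gP gC iK iM]
      E[of gK gP iD iM] E[of gK gP iP iK] E[of gK gP iH iC]
      E[of gK gC iD iC] E[of gK gC iK iC] E[of gK gC iC iM]
      E[of gM gP iP iM]
    by (simp_all add: simps)
  note vals = this
  show thesis
  proof (rule that, rule linear_eq_on_gens)
    \<comment> \<open>The coefficients solve three equations for the coboundary of
      \<open>c1 D\<and>M + c2 P\<and>K + c3 H\<and>C\<close>: its value at \<open>H\<close> has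
      \<open>(H, M)\<close> entry \<open>2 c1\<close> and \<open>(D, H)\<close> entry
      \<open>- c3\<close>, and its value at \<open>P\<close> has \<open>(P, M)\<close> entry
      \<open>c1 - c2\<close>.\<close>
    let ?r = "(\<delta> gH $ iH $ iM / 2) *\<^sub>R (gD \<and>\<^sub>t gM) +
      (\<delta> gH $ iH $ iM / 2 - \<delta> gP $ iP $ iM) *\<^sub>R (gP \<and>\<^sub>t gK) +
      (- \<delta> gH $ iD $ iH) *\<^sub>R (gH \<and>\<^sub>t gC)"
    show "linear (coboundary S_bracket ?r)"
      by (rule linear_coboundary[OF bilinear_S_bracket])
    show "\<delta> gD = coboundary S_bracket ?r gD" "\<delta> gH = coboundary S_bracket ?r gH"
      "\<delta> gP = coboundary S_bracket ?r gP" "\<delta> gK = coboundary S_bracket ?r gK"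
      "\<delta> gC = coboundary S_bracket ?r gC" "\<delta> gM = coboundary S_bracket ?r gM"
      unfolding coboundary_def vec_eq_gen_iff
      by (simp_all add: simps wedge_component vals)
  qed (rule lin)
qed

lemma cocycle_diff:
  assumes "cocycle br \<delta>" "cocycle br \<delta>'"
  shows "cocycle br (\<lambda>X. \<delta> X - \<delta>' X)"
  using assms by (simp add: cocycle_def ad2_diff)

lemma skew_symmetric_diff:
  assumes "skew_symmetric s" "skew_symmetric t"
  shows "skew_symmetric (s - t)"
proof -
  have "transpose (s - t) = transpose s - transpose t"
    by (simp add: transpose_def vec_eq_iff)
  then show ?thesis
    using assms by (simp add: skew_symmetric_def)
qed

lemma skew_symmetric_add:
  assumes "skew_symmetric s" "skew_symmetric t"
  shows "skew_symmetric (s + t)"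
proof -
  have "transpose (s + t) = transpose s + transpose t"
    by (simp add: transpose_def vec_eq_iff)
  then show ?thesis
    using assms by (simp add: skew_symmetric_def)
qed

lemma skew_symmetric_scaleR:
  assumes "skew_symmetric s"
  shows "skew_symmetric (c *\<^sub>R s)"
proof -
  have "transpose (c *\<^sub>R s) = c *\<^sub>R transpose s"
    by (simp add: transpose_def vec_eq_iff)
  then show ?thesis
    using assms by (simp add: skew_symmetric_def)
qed

lemma skew_symmetric_wedge: "skew_symmetric (x \<and>\<^sub>t y)"
  by (simp add: skew_symmetric_iff wedge_component)

lemma coboundary_add: "coboundary br (r + s) X = coboundary br r X + coboundary br s X"
  by (simp add: coboundary_def ad2_add)

lemma cocycle_imp_coboundary:
  assumes lin: "linear \<delta>" and coc: "cocycle S_bracket \<delta>" and skew: "\<And>X. skew_symmetric (\<delta> X)"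
  obtains r where "skew_symmetric r" "\<delta> = coboundary S_bracket r"
proof -
  \<comment> \<open>Dividing by the weight inverts ad D on the components of nonzero weight, so
    \<open>ad D r0\<close> reproduces those components of \<delta>(D). On weight zero
    \<open>r0\<close> is set to zero.\<close>
  define r0 :: "real^gen^gen" where
    "r0 = (\<chi> i j. if weight i + weight j = 0 then 0 else \<delta> gD $ i $ j / (weight i + weight j))"
  define \<epsilon> where "\<epsilon> X = \<delta> X - coboundary S_bracket r0 X" for X
  have "r0 $ i $ j = - r0 $ j $ i" for i j
  proof -
    have "\<delta> gD $ i $ j = - \<delta> gD $ j $ i"
      using skew unfolding skew_symmetric_iff by blast
    then show ?thesis
      by (simp add: r0_def add.commute[of "weight j" "weight i"])
  qed
  then have r0: "skew_symmetric r0"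
    unfolding skew_symmetric_iff by blast
  have lin': "linear \<epsilon>"
    unfolding \<epsilon>_def by (intro linear_compose_sub lin linear_coboundary bilinear_S_bracket)
  have coc': "cocycle S_bracket \<epsilon>"
    unfolding \<epsilon>_def by (intro cocycle_diff coc cocycle_coboundary lie_bracket_S)
  have skew': "skew_symmetric (\<epsilon> X)" for X
    unfolding \<epsilon>_def coboundary_def by (intro skew_symmetric_diff skew skew_symmetric_ad2 r0 linear_S_bracket)
  note sk = skew_symmetric_gen[OF skew']
  have zero: "weight i + weight j \<noteq> 0 \<Longrightarrow> \<epsilon> gD $ i $ j = 0" for i j
    by (simp add: \<epsilon>_def coboundary_def ad2_gD r0_def)
  \<comment> \<open>\<open>ad\<^sub>D\<close> minus the weight of \<open>b\<close> kills the components of \<open>\<epsilon>(b)\<close> on which \<open>ad\<^sub>b \<epsilon>(D)\<close> lives\<close>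
  have "\<epsilon> gD $ iP $ iK = 0" "\<epsilon> gD $ iH $ iC = 0" "\<epsilon> gD $ iD $ iM = 0"
    using cocycle_gD[OF lin' coc', of iP iM iP, folded gP_def] cocycle_gD[OF lin' coc', of iH iK iP, folded gP_def]
      cocycle_gD[OF lin' coc', of iH iM iH, folded gH_def]
    by (simp_all add: ad2_S_component S_components sk zero)
  \<comment> \<open>D\<and>M, P\<and>K and H\<and>C are the only wedges of generators of weight
    zero, so the three entries just treated were the last ones.\<close>
  then have "\<epsilon> gD = 0"
    unfolding vec_eq_gen_iff by (simp add: sk zero)
  then obtain c1 c2 c3 where
    *: "\<epsilon> = coboundary S_bracket (c1 *\<^sub>R (gD \<and>\<^sub>t gM) + c2 *\<^sub>R (gP \<and>\<^sub>t gK) + c3 *\<^sub>R (gH \<and>\<^sub>t gC))"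
    using cocycle_weight_zero[OF lin' coc' skew'] by blast
  show thesis
  proof (rule that)
    let ?r = "c1 *\<^sub>R (gD \<and>\<^sub>t gM) + c2 *\<^sub>R (gP \<and>\<^sub>t gK) + c3 *\<^sub>R (gH \<and>\<^sub>t gC)"
    show "skew_symmetric (?r + r0)"
      by (intro skew_symmetric_add skew_symmetric_scaleR skew_symmetric_wedge r0)
    show "\<delta> = coboundary S_bracket (?r + r0)"
    proof
      fix X
      have "\<delta> X = \<epsilon> X + coboundary S_bracket r0 X"
        by (simp add: \<epsilon>_def)
      then show "\<delta> X = coboundary S_bracket (?r + r0) X"
        by (simp only: * coboundary_add)
    qed
  qed
qed

section \<open>A family of r-matrices\<close>

text \<open>Contains all three lists: \<open>D\<close> primitive keeps only \<open>c1\<close> and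
  \<open>c2\<close>; \<open>P\<close> primitive has \<open>a2 = 0\<close> and
  \<open>c2 = c1\<close>; \<open>H\<close> primitive has \<open>a1 = b3 = c1 = 0\<close>.\<close>

definition r_matrix :: "real \<Rightarrow> real \<Rightarrow> real \<Rightarrow> real \<Rightarrow> real \<Rightarrow> real \<Rightarrow> real \<Rightarrow> real \<Rightarrow> real^gen^gen" where
  "r_matrix a1 a2 a3 a4 a5 b3 c1 c2 =
     a1 *\<^sub>R (gD \<and>\<^sub>t gP) + a2 *\<^sub>R (gD \<and>\<^sub>t gH) + a3 *\<^sub>R (gP \<and>\<^sub>t gM) + a4 *\<^sub>R (gH \<and>\<^sub>t gM) +
     a5 *\<^sub>R (gP \<and>\<^sub>t gH) + b3 *\<^sub>R (gK \<and>\<^sub>t gM) + c1 *\<^sub>R (gD \<and>\<^sub>t gM) + c2 *\<^sub>R (gP \<and>\<^sub>t gK)"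

lemma skew_symmetric_r_matrix: "skew_symmetric (r_matrix a1 a2 a3 a4 a5 b3 c1 c2)"
  unfolding r_matrix_def by (intro skew_symmetric_add skew_symmetric_scaleR skew_symmetric_wedge)

lemma r_matrix_component:
  "r_matrix a1 a2 a3 a4 a5 b3 c1 c2 $ iD = (\<chi> j. a1 * gP $ j + a2 * gH $ j + c1 * gM $ j)"
  "r_matrix a1 a2 a3 a4 a5 b3 c1 c2 $ iH = (\<chi> j. - a2 * gD $ j + a4 * gM $ j - a5 * gP $ j)"
  "r_matrix a1 a2 a3 a4 a5 b3 c1 c2 $ iP =
    (\<chi> j. - a1 * gD $ j + a3 * gM $ j + a5 * gH $ j + c2 * gK $ j)"
  "r_matrix a1 a2 a3 a4 a5 b3 c1 c2 $ iK = (\<chi> j. b3 * gM $ j - c2 * gP $ j)"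
  "r_matrix a1 a2 a3 a4 a5 b3 c1 c2 $ iC = 0"
  "r_matrix a1 a2 a3 a4 a5 b3 c1 c2 $ iM =
    (\<chi> j. - a3 * gP $ j - a4 * gH $ j - b3 * gK $ j - c1 * gD $ j)"
  by (simp_all add: r_matrix_def vec_eq_gen_iff wedge_component)

text \<open>In this expanded form primitivity of a generator can be read off the coefficients, which
  gives the converse directions of the three equivalences.\<close>

lemma coboundary_r_matrix:
  "coboundary S_bracket (r_matrix a1 a2 a3 a4 a5 b3 c1 c2) X =
    (- a1 * X $ iD + a2 * X $ iK + a5 * X $ iC) *\<^sub>R (gD \<and>\<^sub>t gP) - (2 * a2 * X $ iD) *\<^sub>R (gD \<and>\<^sub>t gH) +
    (- a3 * X $ iD - b3 * X $ iH + (c1 - c2) * X $ iP + a4 * X $ iK) *\<^sub>R (gP \<and>\<^sub>t gM) +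
    (- 2 * a4 * X $ iD + 2 * c1 * X $ iH - a5 * X $ iK) *\<^sub>R (gH \<and>\<^sub>t gM) +
    (3 * a5 * X $ iD + 2 * a1 * X $ iH - a2 * X $ iP) *\<^sub>R (gH \<and>\<^sub>t gP) +
    (b3 * X $ iD - (c1 + c2) * X $ iK + a3 * X $ iC) *\<^sub>R (gK \<and>\<^sub>t gM) +
    (a2 * X $ iK - a5 * X $ iC) *\<^sub>R (gH \<and>\<^sub>t gK) + (a1 * X $ iK - a4 * X $ iC) *\<^sub>R (gD \<and>\<^sub>t gM) +
    (a1 * X $ iK) *\<^sub>R (gP \<and>\<^sub>t gK) + (2 * a2 * X $ iC) *\<^sub>R (gH \<and>\<^sub>t gC) + (a1 * X $ iC) *\<^sub>R (gD \<and>\<^sub>t gK) +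
    (2 * a1 * X $ iC) *\<^sub>R (gP \<and>\<^sub>t gC) - (2 * c1 * X $ iC) *\<^sub>R (gC \<and>\<^sub>t gM)"
  unfolding vec_eq_gen_iff coboundary_def ad2_S_component
  by (simp add: S_components r_matrix_component wedge_component algebra_simps)

text \<open>P\<and>K\<and>M as the signed sum over all six permutations, without a factor 1/6, in
  keeping with the convention for \<open>wedge\<close>.\<close>

definition PKM_tensor :: "real^gen^gen^gen" where
  "PKM_tensor = tensor3 gP gK gM + tensor3 gK gM gP + tensor3 gM gP gK
     - tensor3 gP gM gK - tensor3 gM gK gP - tensor3 gK gP gM"

text \<open>\<open>P\<close>, \<open>K\<close>, \<open>M\<close> span a Heisenberg ideal on which
  every ad X has trace zero, so ad X annihilates its top exterior power.\<close>

lemma ad3_PKM_tensor: "ad3 S_bracket X (c *\<^sub>R PKM_tensor) = 0"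
  unfolding vec_eq_gen_iff ad3_S_component
  by (simp add: S_components PKM_tensor_def tensor3_def algebra_simps)


lemma all_gen: "(\<forall>k. Q k) \<longleftrightarrow> Q iD \<and> Q iH \<and> Q iP \<and> Q iK \<and> Q iC \<and> Q iM"
  using gen.induct[of Q] by blast

text \<open>
  The assumptions below say that all components of \<open>[[r, r]]\<close> other than \<open>P \<and> K \<and> M\<close> vanish.
\<close>

lemma schouten_r_matrix:
  assumes "a1 * a2 = 0" "a2 * c1 = 0" "a2 * b3 = 0" "a1 * (c1 - c2) = 0"
    and "a2 * a3 + a5 * c2 = 2 * a1 * a4 + 3 * a5 * c1"
  shows "schouten S_bracket (r_matrix a1 a2 a3 a4 a5 b3 c1 c2) = - (a1 * b3 + c2\<^sup>2) *\<^sub>R PKM_tensor"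
  unfolding vec_eq_gen_iff schouten_S_component
  by (simp add: S_components r_matrix_component PKM_tensor_def tensor3_def,
      intro conjI; insert assms; (algebra | simp add: power2_eq_square))

section \<open>The co-Jacobi identity on the family and the standard/non-standard dichotomy\<close>

lemma S_basis: "basis_vec iD = gD" "basis_vec iH = gH" "basis_vec iP = gP"
  "basis_vec iK = gK" "basis_vec iC = gC" "basis_vec iM = gM"
  by (simp_all add: gD_def gH_def gP_def gK_def gC_def gM_def)

text \<open>The entries on and above the diagonal, as rewrite rules; with
  \<open>skew_symmetric_gen\<close> they turn the co-Jacobi identity into polynomial identities in
  the parameters and the coordinates of \<open>X\<close>.\<close>

lemma coboundary_r_matrix_component:
  fixes a1 a2 a3 a4 a5 b3 c1 c2 :: real and X :: schr
  defines "d \<equiv> coboundary S_bracket (r_matrix a1 a2 a3 a4 a5 b3 c1 c2) X"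
  shows
  "d $ iD $ iD = 0"
  "d $ iD $ iH = - 2 * a2 * X $ iD"
  "d $ iD $ iP = - a1 * X $ iD + a2 * X $ iK + a5 * X $ iC"
  "d $ iD $ iK = a1 * X $ iC"
  "d $ iD $ iC = 0"
  "d $ iD $ iM = a1 * X $ iK - a4 * X $ iC"
  "d $ iH $ iH = 0"
  "d $ iH $ iP = 3 * a5 * X $ iD + 2 * a1 * X $ iH - a2 * X $ iP"
  "d $ iH $ iK = a2 * X $ iK - a5 * X $ iC"
  "d $ iH $ iC = 2 * a2 * X $ iC"
  "d $ iH $ iM = - 2 * a4 * X $ iD + 2 * c1 * X $ iH - a5 * X $ iK"
  "d $ iP $ iP = 0"
  "d $ iP $ iK = a1 * X $ iK"
  "d $ iP $ iC = 2 * a1 * X $ iC"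
  "d $ iP $ iM = - a3 * X $ iD - b3 * X $ iH + (c1 - c2) * X $ iP + a4 * X $ iK"
  "d $ iK $ iK = 0"
  "d $ iK $ iC = 0"
  "d $ iK $ iM = b3 * X $ iD - (c1 + c2) * X $ iK + a3 * X $ iC"
  "d $ iC $ iC = 0"
  "d $ iC $ iM = - 2 * c1 * X $ iC"
  "d $ iM $ iM = 0"
  unfolding d_def coboundary_def ad2_S_component
  by (simp_all add: S_components r_matrix_component algebra_simps)

text \<open>The conditions are those of \<open>schouten_r_matrix\<close>: for a skew
  \<open>r\<close> the co-Jacobi identity amounts to invariance of \<open>[[r, r]]\<close>, which
  under them is a multiple of P\<and>K\<and>M. The proof verifies the polynomial identities
  directly.\<close>

lemma co_jacobiator_r_matrix:
  assumes "a1 * a2 = 0" "a2 * c1 = 0" "a2 * b3 = 0" "a1 * (c1 - c2) = 0"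
    and "a2 * a3 + a5 * c2 = 2 * a1 * a4 + 3 * a5 * c1"
  shows "\<forall>i j k. co_jacobiator (coboundary S_bracket (r_matrix a1 a2 a3 a4 a5 b3 c1 c2)) X i j k = 0"
proof -
  have "skew_symmetric (coboundary S_bracket (r_matrix a1 a2 a3 a4 a5 b3 c1 c2) X)" for X
    unfolding coboundary_def by (rule skew_symmetric_ad2[OF linear_S_bracket skew_symmetric_r_matrix])
  note sk = skew_symmetric_gen[OF this]
  show ?thesis
    unfolding co_jacobiator_def sum_UNIV_gen S_basis all_gen
    by (simp add: coboundary_r_matrix_component sk,
        intro conjI; insert assms; (algebra | simp add: algebra_simps))
qed

text \<open>\<open>[[r, r]]\<close> is a scalar multiple of a nonzero invariant tensor, so the
  scalar \<open>a1 * b3 + c2\<^sup>2\<close> alone decides the type.\<close>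

lemma r_matrix_standard_nonstandard:
  assumes "a1 * a2 = 0" "a2 * c1 = 0" "a2 * b3 = 0" "a1 * (c1 - c2) = 0"
    and "a2 * a3 + a5 * c2 = 2 * a1 * a4 + 3 * a5 * c1"
  shows "a1 * b3 + c2\<^sup>2 \<noteq> 0 \<Longrightarrow> standard S_bracket (r_matrix a1 a2 a3 a4 a5 b3 c1 c2)"
    and "a1 * b3 + c2\<^sup>2 = 0 \<Longrightarrow> nonstandard S_bracket (r_matrix a1 a2 a3 a4 a5 b3 c1 c2)"
proof -
  have "coboundary_lie_bialgebra S_bracket (r_matrix a1 a2 a3 a4 a5 b3 c1 c2)"
    using co_jacobiator_r_matrix[OF assms]
    by (simp add: coboundary_lie_bialgebra_iff[OF lie_bracket_S] skew_symmetric_r_matrix)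
  moreover have "PKM_tensor \<noteq> 0"
  proof
    assume "PKM_tensor = 0"
    then have "PKM_tensor $ iP $ iK $ iM = 0" by simp
    then show False by (simp add: PKM_tensor_def tensor3_def)
  qed
  ultimately show "a1 * b3 + c2\<^sup>2 \<noteq> 0 \<Longrightarrow> standard S_bracket (r_matrix a1 a2 a3 a4 a5 b3 c1 c2)"
    "a1 * b3 + c2\<^sup>2 = 0 \<Longrightarrow> nonstandard S_bracket (r_matrix a1 a2 a3 a4 a5 b3 c1 c2)"
    by (simp_all only: standard_def nonstandard_def ad_invariant3_def schouten_r_matrix[OF assms]
        ad3_PKM_tensor scaleR_eq_0_iff neg_equal_0_iff_equal) simp_all
qed

section \<open>Primitive generators\<close>

lemma primitive_gD:
  assumes skew: "skew_symmetric r" and prim: "ad2 S_bracket gD r = 0"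
    and jac: "\<And>X i j k. co_jacobiator (coboundary S_bracket r) X i j k = 0"
  obtains c1 c2 where "r = r_matrix 0 0 0 0 0 0 c1 c2"
proof -
  note sk = skew_symmetric_gen[OF skew]
  have zero: "weight i + weight j \<noteq> 0 \<Longrightarrow> r $ i $ j = 0" for i j
    using ad2_gD[of r i j] prim by simp
  \<comment> \<open>Invariance under \<open>D\<close> leaves the entries of D\<and>M, P\<and>K and
    H\<and>C. This co-Jacobi component is minus the square of the last one.\<close>
  have "r $ iH $ iC = 0"
    using jac[of gP iD iH iK]
    by (simp add: co_jacobiator_def sum_UNIV_gen S_basis coboundary_def ad2_S_component S_components sk zero)
  then have "r = r_matrix 0 0 0 0 0 0 (r $ iD $ iM) (r $ iP $ iK)"
    unfolding vec_eq_gen_iff by (simp add: r_matrix_component sk zero)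
  then show thesis by (rule that)
qed

lemma primitive_gP:
  assumes skew: "skew_symmetric r" and prim: "ad2 S_bracket gP r = 0"
    and jac: "\<And>X i j k. co_jacobiator (coboundary S_bracket r) X i j k = 0"
  obtains a1 a3 a4 a5 b3 c1 where "a1 * a4 + a5 * c1 = 0" "r = r_matrix a1 0 a3 a4 a5 b3 c1 c1"
proof -
  note sk = skew_symmetric_gen[OF skew]
  have "ad2 S_bracket gP r $ i $ j = 0" for i j
    using prim by simp
  note this[of iH iP] this[of iD iK] this[of iP iC] this[of iP iK] this[of iD iM] this[of iP iM] this[of iH iM]
    this[of iH iK] this[of iC iM] this[of iK iM]
  then have vals: "r $ iD $ iH = 0" "r $ iD $ iC = 0" "r $ iD $ iK = 0" "r $ iP $ iC = 0"
    "r $ iP $ iK = r $ iD $ iM" "r $ iH $ iK = 0" "r $ iH $ iC = 0" "r $ iK $ iC = 0" "r $ iC $ iM = 0"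
    by (simp_all add: ad2_S_component S_components sk)
  show thesis
  proof (rule that)
    \<comment> \<open>The co-Jacobi component used is six times this expression. The coefficient
      \<open>a5\<close> is \<open>- r $ iH $ iP\<close> because the family contains
      P\<and>H.\<close>
    show "r $ iD $ iP * r $ iH $ iM + (- r $ iH $ iP) * r $ iD $ iM = 0"
      using jac[of gD iH iP iM]
      by (simp add: co_jacobiator_def sum_UNIV_gen S_basis coboundary_def ad2_S_component S_components sk vals)
    show "r = r_matrix (r $ iD $ iP) 0 (r $ iP $ iM) (r $ iH $ iM) (- r $ iH $ iP) (r $ iK $ iM)
        (r $ iD $ iM) (r $ iD $ iM)"
      unfolding vec_eq_gen_iff by (simp add: r_matrix_component sk vals)
  qed
qed

lemma primitive_gH:
  assumes skew: "skew_symmetric r" and prim: "ad2 S_bracket gH r = 0"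
    and jac: "\<And>X i j k. co_jacobiator (coboundary S_bracket r) X i j k = 0"
  obtains a2 a3 a4 a5 c2 where "a2 * a3 + a5 * c2 = 0" "r = r_matrix 0 a2 a3 a4 a5 0 0 c2"
proof -
  note sk = skew_symmetric_gen[OF skew]
  have "ad2 S_bracket gH r $ i $ j = 0" for i j
    using prim by simp
  note this[of iD iH] this[of iD iP] this[of iD iK] this[of iD iC] this[of iD iM] this[of iH iP] this[of iH iK]
    this[of iH iC] this[of iH iM] this[of iP iK] this[of iP iC] this[of iP iM] this[of iK iC]
    this[of iK iM] this[of iC iM]
  then have vals: "r $ iH $ iC = 0" "r $ iD $ iC = 0" "r $ iD $ iK = 0" "r $ iP $ iC = 0" "r $ iK $ iC = 0"
    "r $ iC $ iM = 0" "r $ iD $ iM = 0" "r $ iK $ iM = 0" "r $ iH $ iK = 2 * r $ iD $ iP"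
    by (simp_all add: ad2_S_component S_components sk)
  \<comment> \<open>Invariance under \<open>H\<close> only ties this entry to that of H\<and>K. The
    co-Jacobi component is four times its square.\<close>
  have DP: "r $ iD $ iP = 0"
    using jac[of gD iD iH iM]
    by (simp add: co_jacobiator_def sum_UNIV_gen S_basis coboundary_def ad2_S_component S_components sk vals)
  show thesis
  proof (rule that)
    \<comment> \<open>Here the co-Jacobi component is minus three times the expression.\<close>
    show "r $ iD $ iH * r $ iP $ iM + (- r $ iH $ iP) * r $ iP $ iK = 0"
      using jac[of gD iH iP iM]
      by (simp add: co_jacobiator_def sum_UNIV_gen S_basis coboundary_def ad2_S_component S_components sk vals DP)
    show "r = r_matrix 0 (r $ iD $ iH) (r $ iP $ iM) (r $ iH $ iM) (- r $ iH $ iP) 0 0 (r $ iP $ iK)"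
      unfolding vec_eq_gen_iff by (simp add: r_matrix_component sk vals DP)
  qed
qed

theorem mainTheorem3:
  fixes \<delta> :: "schr \<Rightarrow> real^gen^gen"
  assumes "lie_bialgebra S_bracket \<delta>"
  shows
    "((primitive \<delta> gD \<longleftrightarrow>
        (\<exists>c1 c2 :: real. \<delta> = coboundary S_bracket (c1 *\<^sub>R (gD \<and>\<^sub>t gM) + c2 *\<^sub>R (gP \<and>\<^sub>t gK))))
     \<and> (\<forall>(c1::real) (c2::real) r.
          r = c1 *\<^sub>R (gD \<and>\<^sub>t gM) + c2 *\<^sub>R (gP \<and>\<^sub>t gK) \<longrightarrow>
            (c2 \<noteq> 0 \<longrightarrow> standard S_bracket r) \<and>
            (c2 = 0 \<longrightarrow> nonstandard S_bracket r)))
     \<and>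
    ((primitive \<delta> gP \<longleftrightarrow>
        (\<exists>a1 a3 a4 a5 b3 c1 :: real.
           a1 * a4 + a5 * c1 = 0 \<and>
           \<delta> = coboundary S_bracket
                 (a1 *\<^sub>R (gD \<and>\<^sub>t gP) + a3 *\<^sub>R (gP \<and>\<^sub>t gM) + a4 *\<^sub>R (gH \<and>\<^sub>t gM)
                  + a5 *\<^sub>R (gP \<and>\<^sub>t gH) + b3 *\<^sub>R (gK \<and>\<^sub>t gM) + c1 *\<^sub>R (gD \<and>\<^sub>t gM + gP \<and>\<^sub>t gK))))
     \<and> (\<forall>(a1::real) (a3::real) (a4::real) (a5::real) (b3::real) (c1::real) r.
          a1 * a4 + a5 * c1 = 0 \<and>
          r = a1 *\<^sub>R (gD \<and>\<^sub>t gP) + a3 *\<^sub>R (gP \<and>\<^sub>t gM) + a4 *\<^sub>R (gH \<and>\<^sub>t gM)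
              + a5 *\<^sub>R (gP \<and>\<^sub>t gH) + b3 *\<^sub>R (gK \<and>\<^sub>t gM) + c1 *\<^sub>R (gD \<and>\<^sub>t gM + gP \<and>\<^sub>t gK) \<longrightarrow>
            (a1 * b3 + c1\<^sup>2 \<noteq> 0 \<longrightarrow> standard S_bracket r) \<and>
            (a1 * b3 + c1\<^sup>2 = 0 \<longrightarrow> nonstandard S_bracket r)))
     \<and>
    ((primitive \<delta> gH \<longleftrightarrow>
        (\<exists>a2 a3 a4 a5 c2 :: real.
           a2 * a3 + a5 * c2 = 0 \<and>
           \<delta> = coboundary S_bracket
                 (a2 *\<^sub>R (gD \<and>\<^sub>t gH) + a3 *\<^sub>R (gP \<and>\<^sub>t gM) + a4 *\<^sub>R (gH \<and>\<^sub>t gM)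
                  + a5 *\<^sub>R (gP \<and>\<^sub>t gH) + c2 *\<^sub>R (gP \<and>\<^sub>t gK))))
     \<and> (\<forall>(a2::real) (a3::real) (a4::real) (a5::real) (c2::real) r.
          a2 * a3 + a5 * c2 = 0 \<and>
          r = a2 *\<^sub>R (gD \<and>\<^sub>t gH) + a3 *\<^sub>R (gP \<and>\<^sub>t gM) + a4 *\<^sub>R (gH \<and>\<^sub>t gM)
              + a5 *\<^sub>R (gP \<and>\<^sub>t gH) + c2 *\<^sub>R (gP \<and>\<^sub>t gK) \<longrightarrow>
            (c2 \<noteq> 0 \<longrightarrow> standard S_bracket r \<and> a5 = - (a2 * a3) / c2) \<and>
            (c2 = 0 \<longrightarrow> nonstandard S_bracket r \<and>
               (a2 = 0 \<and> primitive (coboundary S_bracket r) gP \<or>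
                a3 = 0 \<and> r = a2 *\<^sub>R (gD \<and>\<^sub>t gH) + a4 *\<^sub>R (gH \<and>\<^sub>t gM) + a5 *\<^sub>R (gP \<and>\<^sub>t gH)))))"
proof -
  have lin: "linear \<delta>" and coc: "cocycle S_bracket \<delta>"
    using assms by (auto simp: lie_bialgebra_def)
  have skew: "\<And>X. skew_symmetric (\<delta> X)" and jac: "\<And>X i j k. co_jacobiator \<delta> X i j k = 0"
    using assms lie_bracket_dual_iff[OF lin] by (auto simp: lie_bialgebra_def)
  obtain r where r: "skew_symmetric r" and \<delta>: "\<delta> = coboundary S_bracket r"
    using cocycle_imp_coboundary[OF lin coc skew] .
  have prim: "primitive \<delta> X \<longleftrightarrow> ad2 S_bracket X r = 0" for X
    by (simp add: primitive_def \<delta> coboundary_def)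
  note jac = jac[unfolded \<delta>]
  have D: "c1 *\<^sub>R (gD \<and>\<^sub>t gM) + c2 *\<^sub>R (gP \<and>\<^sub>t gK) = r_matrix 0 0 0 0 0 0 c1 c2" for c1 c2
    by (simp add: r_matrix_def)
  have P: "a1 *\<^sub>R (gD \<and>\<^sub>t gP) + a3 *\<^sub>R (gP \<and>\<^sub>t gM) + a4 *\<^sub>R (gH \<and>\<^sub>t gM) + a5 *\<^sub>R (gP \<and>\<^sub>t gH) +
      b3 *\<^sub>R (gK \<and>\<^sub>t gM) + c1 *\<^sub>R (gD \<and>\<^sub>t gM + gP \<and>\<^sub>t gK) = r_matrix a1 0 a3 a4 a5 b3 c1 c1"
    for a1 a3 a4 a5 b3 c1
    by (simp add: r_matrix_def algebra_simps)
  have H: "a2 *\<^sub>R (gD \<and>\<^sub>t gH) + a3 *\<^sub>R (gP \<and>\<^sub>t gM) + a4 *\<^sub>R (gH \<and>\<^sub>t gM) + a5 *\<^sub>R (gP \<and>\<^sub>t gH) +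
      c2 *\<^sub>R (gP \<and>\<^sub>t gK) = r_matrix 0 a2 a3 a4 a5 0 0 c2"
    for a2 a3 a4 a5 c2
    by (simp add: r_matrix_def)
  have H': "a2 *\<^sub>R (gD \<and>\<^sub>t gH) + a4 *\<^sub>R (gH \<and>\<^sub>t gM) + a5 *\<^sub>R (gP \<and>\<^sub>t gH) = r_matrix 0 a2 0 a4 a5 0 0 0"
    for a2 a4 a5
    by (simp add: r_matrix_def)
  have d1: "primitive \<delta> gD \<longleftrightarrow> (\<exists>c1 c2. \<delta> = coboundary S_bracket (r_matrix 0 0 0 0 0 0 c1 c2))"
  proof
    assume "primitive \<delta> gD"
    then have "ad2 S_bracket gD r = 0"
      by (simp only: prim)
    from primitive_gD[OF r this jac] obtain c1 c2
      where "r = r_matrix 0 0 0 0 0 0 c1 c2" .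
    then show "\<exists>c1 c2. \<delta> = coboundary S_bracket (r_matrix 0 0 0 0 0 0 c1 c2)"
      using \<delta> by blast
  qed (auto simp: primitive_def coboundary_r_matrix)
  have d2: "(c2 \<noteq> 0 \<longrightarrow> standard S_bracket (r_matrix 0 0 0 0 0 0 c1 c2)) \<and>
      (c2 = 0 \<longrightarrow> nonstandard S_bracket (r_matrix 0 0 0 0 0 0 c1 c2))" for c1 c2
    \<comment> \<open>The arguments are in the order \<open>a1 a2 c1 b3 c2 a3 a5 a4\<close>, in
      which the parameters first occur in the assumptions.\<close>
    using r_matrix_standard_nonstandard[of 0 0 c1 0 c2 0 0 0] by simp
  have p1: "primitive \<delta> gP \<longleftrightarrow> (\<exists>a1 a3 a4 a5 b3 c1. a1 * a4 + a5 * c1 = 0 \<and>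
      \<delta> = coboundary S_bracket (r_matrix a1 0 a3 a4 a5 b3 c1 c1))"
  proof
    assume "primitive \<delta> gP"
    then have "ad2 S_bracket gP r = 0"
      by (simp only: prim)
    from primitive_gP[OF r this jac] obtain a1 a3 a4 a5 b3 c1
      where "a1 * a4 + a5 * c1 = 0" "r = r_matrix a1 0 a3 a4 a5 b3 c1 c1" .
    then show "\<exists>a1 a3 a4 a5 b3 c1. a1 * a4 + a5 * c1 = 0 \<and>
      \<delta> = coboundary S_bracket (r_matrix a1 0 a3 a4 a5 b3 c1 c1)"
      using \<delta> by blast
  qed (auto simp: primitive_def coboundary_r_matrix)
  \<comment> \<open>With \<open>a2 = 0\<close> and \<open>c2 = c1\<close> the last condition on the
    family becomes twice \<open>a1 * a4 + a5 * c1 = 0\<close>.\<close>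
  have p2: "(a1 * b3 + c1\<^sup>2 \<noteq> 0 \<longrightarrow> standard S_bracket (r_matrix a1 0 a3 a4 a5 b3 c1 c1)) \<and>
      (a1 * b3 + c1\<^sup>2 = 0 \<longrightarrow> nonstandard S_bracket (r_matrix a1 0 a3 a4 a5 b3 c1 c1))"
    if "a1 * a4 + a5 * c1 = 0" for a1 a3 a4 a5 b3 c1
    using r_matrix_standard_nonstandard[of a1 0 c1 b3 c1 a3 a5 a4] that by (simp add: algebra_simps)
  have h1: "primitive \<delta> gH \<longleftrightarrow> (\<exists>a2 a3 a4 a5 c2. a2 * a3 + a5 * c2 = 0 \<and>
      \<delta> = coboundary S_bracket (r_matrix 0 a2 a3 a4 a5 0 0 c2))"
  proof
    assume "primitive \<delta> gH"
    then have "ad2 S_bracket gH r = 0"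
      by (simp only: prim)
    from primitive_gH[OF r this jac] obtain a2 a3 a4 a5 c2
      where "a2 * a3 + a5 * c2 = 0" "r = r_matrix 0 a2 a3 a4 a5 0 0 c2" .
    then show "\<exists>a2 a3 a4 a5 c2. a2 * a3 + a5 * c2 = 0 \<and>
      \<delta> = coboundary S_bracket (r_matrix 0 a2 a3 a4 a5 0 0 c2)"
      using \<delta> by blast
  qed (auto simp: primitive_def coboundary_r_matrix)
  \<comment> \<open>For \<open>c2 = 0\<close> the constraint is \<open>a2 * a3 = 0\<close>, which
    gives the two cases. If \<open>a2 = 0\<close>, then \<delta>(P) vanishes, since on this list its
    only terms are multiples of \<open>a2\<close> and \<open>c2\<close>.\<close>
  have h2: "(c2 \<noteq> 0 \<longrightarrow> standard S_bracket (r_matrix 0 a2 a3 a4 a5 0 0 c2) \<and> a5 = - (a2 * a3) / c2) \<and>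
      (c2 = 0 \<longrightarrow> nonstandard S_bracket (r_matrix 0 a2 a3 a4 a5 0 0 c2) \<and>
        (a2 = 0 \<and> primitive (coboundary S_bracket (r_matrix 0 a2 a3 a4 a5 0 0 c2)) gP \<or>
         a3 = 0 \<and> r_matrix 0 a2 a3 a4 a5 0 0 c2 = r_matrix 0 a2 0 a4 a5 0 0 0))"
    if "a2 * a3 + a5 * c2 = 0" for a2 a3 a4 a5 c2
    using r_matrix_standard_nonstandard[of 0 a2 0 0 c2 a3 a5 a4] that
    by (auto simp: primitive_def coboundary_r_matrix field_simps)
  show ?thesis
    unfolding D P H H'
    by (intro conjI d1 p1 h1; intro allI impI; (elim conjE)?; hypsubst)
      (rule d2, rule p2, assumption, rule h2, assumption)
qed

end
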